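(* Let $(X,Y)$ be a bivariate random vector such that $X-Y$ (equivalently $Y-X$) has a continuous distribution function, and let $(X_i,Y_i)_{i\ge 1}$ be i.i.d. copies of $(X,Y)$. For $n\ge 1$ let $$\overline F_n(t)=\frac1n\sum_{i=1}^n I_{(t,+\infty)}(X_i-Y_i),\qquad \overline G_n(t)=\frac1n\sum_{i=1}^n I_{(t,+\infty)}(Y_i-X_i),\qquad S_n^{st:wj}=\sqrt n\,\sup_{t\in[0,+\infty)}\{\overline F_n(t)-\overline G_n(t)\}.$$ Suppose the alternative hypothesis $H_1: X\nleq_{\mathrm{st:wj}}Y$ holds. Then for every $c\in\mathbb R$, $$\lim_{n\to+\infty}P\left(S_n^{st:wj}>c\right)=1.$$
   Context: For a bivariate random vector $(X,Y)$, $X$ is smaller than $Y$ in the weak joint stochastic dominance, written $X\le_{\mathrm{st:wj}}Y$, if $P(X-Y>t)\le P(Y-X>t)$ for all $t\in\mathbb R$; $X\nleq_{\mathrm{st:wj}}Y$ means that this fails. $I_{(t,+\infty)}$ denotes the indicator function of the interval $(t,+\infty)$. *)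

theory Defs
  imports "HOL-Probability.Probability"
begin

definition st_wj_le :: "'a measure \<Rightarrow> ('a \<Rightarrow> real) \<Rightarrow> ('a \<Rightarrow> real) \<Rightarrow> bool" where
  "st_wj_le M X Y \<longleftrightarrow>
     (\<forall>t::real. measure M {\<omega> \<in> space M. X \<omega> - Y \<omega> > t} \<le> measure M {\<omega> \<in> space M. Y \<omega> - X \<omega> > t})"

(* Samples are indexed from 1; only v 1, ..., v n are used. *)
definition emp_surv :: "nat \<Rightarrow> (nat \<Rightarrow> real) \<Rightarrow> real \<Rightarrow> real" where
  "emp_surv n v t = (1 / real n) * (\<Sum>i=1..n. indicator {t<..} (v i))"

(* The supremum is over a nonempty set bounded by 1, since emp_surv takes values in [0,1],
   so SUP on the reals is the genuine supremum. *)
definition S_st_wj :: "nat \<Rightarrow> (nat \<Rightarrow> real) \<Rightarrow> (nat \<Rightarrow> real) \<Rightarrow> real" where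
  "S_st_wj n x y =
     sqrt (real n) *
     (SUP t\<in>{0..}. emp_surv n (\<lambda>i. x i - y i) t - emp_surv n (\<lambda>i. y i - x i) t)"

end

theory Submission
  imports Defs "HOL-Real_Asymp.Real_Asymp"
begin

text \<open>
  Failure of the dominance yields, through continuity of the distribution function at \<open>\<bar>t\<bar>\<close>, a
  level \<open>s \<ge> 0\<close> at which \<open>P (X - Y > s)\<close> exceeds \<open>P (Y - X > s)\<close> by some \<open>\<delta> > 0\<close>. The statistic is
  at least \<open>sqrt n\<close> times the empirical difference at \<open>s\<close>, which by Hoeffding's inequality exceeds
  \<open>\<delta> / 2\<close> with probability tending to 1. Right continuity of the empirical survival functions
  reduces the supremum to rational levels, so the events in question are measurable.
\<close>

text \<open>If \<open>t < x\<close>, both indicators are 1 for all \<open>s\<close> up to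
  \<open>x\<close>; otherwise both are 0 for every \<open>s > t\<close>, and the bound
  \<open>t + 1\<close> is arbitrary. Openness of the half-line is what makes this work from the
  right.\<close>

lemma eventually_indicator_greaterThan_at_right:
  fixes x t :: real
  shows "eventually (\<lambda>s. indicator {s<..} x = (indicator {t<..} x :: real)) (at_right t)"
proof (cases "t < x")
  case True
  then show ?thesis
    by (auto simp: eventually_at_right_field intro!: exI[of _ x])
next
  case False
  then show ?thesis
    by (auto simp: eventually_at_right_field intro!: exI[of _ "t + 1"])
qed

lemma eventually_emp_surv_at_right: "eventually (\<lambda>s. emp_surv n v s = emp_surv n v t) (at_right t)"
proof -
  have "eventually (\<lambda>s. \<forall>i\<in>{1..n}. indicator {s<..} (v i) = (indicator {t<..} (v i) :: real))
          (at_right t)"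
    by (intro eventually_ball_finite ballI eventually_indicator_greaterThan_at_right) auto
  then show ?thesis
    by eventually_elim (simp add: emp_surv_def)
qed

lemma emp_surv_nonneg: "0 \<le> emp_surv n v t"
  by (simp add: emp_surv_def sum_nonneg)

lemma emp_surv_le_1: "emp_surv n v t \<le> 1"
proof -
  have "(\<Sum>i=1..n. indicator {t<..} (v i) :: real) \<le> (\<Sum>i=1..n. 1)"
    by (intro sum_mono) (auto simp: indicator_def)
  then show ?thesis
    by (simp add: emp_surv_def divide_simps)
qed

lemma borel_measurable_emp_surv:
  assumes "\<And>i. i \<in> {1..n} \<Longrightarrow> V i \<in> borel_measurable M"
  shows "(\<lambda>\<omega>. emp_surv n (\<lambda>i. V i \<omega>) t) \<in> borel_measurable M"
proof -
  have "(\<lambda>\<omega>. indicator {t<..} (V i \<omega>) :: real) \<in> borel_measurable M" if "i \<in> {1..n}" for i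
    using assms[OF that] by measurable
  then show ?thesis
    unfolding emp_surv_def by (intro borel_measurable_times borel_measurable_sum) auto
qed

text \<open>A supremum strictly exceeds a number exactly when one of the values does, provided the
  values are bounded above. Since \<open>n > 0\<close>, the factor \<open>sqrt n\<close> can be
  moved to the other side.\<close>

lemma less_S_st_wj_iff:
  assumes "n > 0"
  shows "c < S_st_wj n x y \<longleftrightarrow>
    (\<exists>t\<in>{0..}. c / sqrt n < emp_surv n (\<lambda>i. x i - y i) t - emp_surv n (\<lambda>i. y i - x i) t)"
proof -
  let ?f = "\<lambda>t. emp_surv n (\<lambda>i. x i - y i) t - emp_surv n (\<lambda>i. y i - x i) t"
  have "?f t \<le> 1" for t
    using emp_surv_le_1[of n "\<lambda>i. x i - y i" t] emp_surv_nonneg[of n "\<lambda>i. y i - x i" t] by linarith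
  then have "bdd_above (?f ` {0..})"
    by (auto intro!: bdd_aboveI2)
  moreover have "c < S_st_wj n x y \<longleftrightarrow> c / sqrt n < (SUP t\<in>{0..}. ?f t)"
    using assms by (simp add: S_st_wj_def pos_divide_less_eq mult.commute)
  ultimately show ?thesis
    by (simp add: less_cSUP_iff)
qed

lemma less_S_st_wj_iff_Rats:
  assumes "n > 0"
  shows "c < S_st_wj n x y \<longleftrightarrow>
    (\<exists>t\<in>\<rat> \<inter> {0..}. c / sqrt n < emp_surv n (\<lambda>i. x i - y i) t - emp_surv n (\<lambda>i. y i - x i) t)"
    (is "_ \<longleftrightarrow> (\<exists>t\<in>_. ?P t)")
proof
  assume "c < S_st_wj n x y"
  then obtain t where t: "t \<ge> 0" "?P t"
    using assms by (auto simp: less_S_st_wj_iff)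
  have "eventually ?P (at_right t)"
    using eventually_emp_surv_at_right[of n "\<lambda>i. x i - y i" t]
      eventually_emp_surv_at_right[of n "\<lambda>i. y i - x i" t]
    by eventually_elim (use t in simp)
  then obtain b where b: "b > t" "\<And>s. t < s \<Longrightarrow> s < b \<Longrightarrow> ?P s"
    by (auto simp: eventually_at_right_field)
  \<comment> \<open>The rational level is taken to the right of \<open>t\<close>, so it stays in the
    range \<open>{0..}\<close> and in the interval where the empirical difference keeps its value at
    \<open>t\<close>.\<close>
  obtain q where "q \<in> \<rat>" "t < q" "q < b"
    using Rats_dense_in_real[OF b(1)] by blast
  then show "\<exists>t\<in>\<rat> \<inter> {0..}. ?P t"
    using b t by (intro bexI[of _ q]) auto
qed (use assms in \<open>auto simp: less_S_st_wj_iff\<close>)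

text \<open>With rational levels the event is a countable union of events, each given by a
  measurable empirical difference.\<close>

lemma sets_less_S_st_wj:
  assumes "n > 0"
    and "\<And>i. i \<in> {1..n} \<Longrightarrow> U i \<in> borel_measurable M"
    and "\<And>i. i \<in> {1..n} \<Longrightarrow> V i \<in> borel_measurable M"
  shows "{\<omega> \<in> space M. c < S_st_wj n (\<lambda>i. U i \<omega>) (\<lambda>i. V i \<omega>)} \<in> sets M"
proof -
  have [measurable]: "(\<lambda>\<omega>. emp_surv n (\<lambda>i. U i \<omega> - V i \<omega>) t) \<in> borel_measurable M"
    "(\<lambda>\<omega>. emp_surv n (\<lambda>i. V i \<omega> - U i \<omega>) t) \<in> borel_measurable M" for t
    using assms by (auto intro!: borel_measurable_emp_surv borel_measurable_diff)
  have "countable (\<rat> \<inter> {0..} :: real set)"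
    using countable_rat by (rule countable_subset[rotated]) auto
  then show ?thesis
    unfolding less_S_st_wj_iff_Rats[OF assms(1)] by measurable
qed

text \<open>A violation at \<open>t < 0\<close> reflects to one at \<open>-t\<close>: taking
  complements turns it into \<open>P (Y - X \<ge> -t) < P (X - Y \<ge> -t)\<close>, and both
  inequalities inside can be made strict because \<open>X - Y\<close> has no atom at
  \<open>-t\<close>.\<close>

lemma (in prob_space) not_st_wj_le_nonneg_level:
  assumes [measurable]: "X \<in> borel_measurable M" "Y \<in> borel_measurable M"
    and cont: "continuous_on UNIV (cdf (distr M borel (\<lambda>\<omega>. X \<omega> - Y \<omega>)))"
    and "\<not> st_wj_le M X Y"
  obtains s where "s \<ge> 0"
    "prob {\<omega> \<in> space M. Y \<omega> - X \<omega> > s} < prob {\<omega> \<in> space M. X \<omega> - Y \<omega> > s}"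
proof -
  obtain t where t: "prob {\<omega> \<in> space M. Y \<omega> - X \<omega> > t} < prob {\<omega> \<in> space M. X \<omega> - Y \<omega> > t}"
    using assms by (auto simp: st_wj_le_def not_le)
  show thesis
  proof (cases "t \<ge> 0")
    case True
    then show thesis
      using t that by blast
  next
    case False
    interpret D: prob_space "distr M borel (\<lambda>\<omega>. X \<omega> - Y \<omega>)"
      by (rule prob_space_distr) simp
    interpret D: real_distribution "distr M borel (\<lambda>\<omega>. X \<omega> - Y \<omega>)"
      by unfold_locales simp_all
    have "measure (distr M borel (\<lambda>\<omega>. X \<omega> - Y \<omega>)) {-t} = 0"
      using cont D.isCont_cdf by (auto simp: continuous_on_eq_continuous_at)
    then have no_atom: "prob {\<omega> \<in> space M. X \<omega> - Y \<omega> = -t} = 0"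
      by (subst (asm) measure_distr) (auto simp: vimage_def Int_def conj_commute)
    have "prob {\<omega> \<in> space M. Y \<omega> - X \<omega> > -t} \<le> prob {\<omega> \<in> space M. \<not> X \<omega> - Y \<omega> > t}"
      by (intro finite_measure_mono) auto
    also have "\<dots> = 1 - prob {\<omega> \<in> space M. X \<omega> - Y \<omega> > t}"
      by (rule prob_neg) simp
    also have "\<dots> < 1 - prob {\<omega> \<in> space M. Y \<omega> - X \<omega> > t}"
      using t by simp
    also have "\<dots> = prob {\<omega> \<in> space M. \<not> Y \<omega> - X \<omega> > t}"
      by (rule prob_neg[symmetric]) simp
    \<comment> \<open>The complement is the event \<open>X - Y \<ge> -t\<close>; its boundary part
      is split off so that \<open>no_atom\<close> removes it.\<close>
    also have "\<dots> = prob ({\<omega> \<in> space M. X \<omega> - Y \<omega> > -t} \<union> {\<omega> \<in> space M. X \<omega> - Y \<omega> = -t})"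
      by (rule arg_cong[where f = prob]) auto
    also have "\<dots> \<le> prob {\<omega> \<in> space M. X \<omega> - Y \<omega> > -t} + prob {\<omega> \<in> space M. X \<omega> - Y \<omega> = -t}"
      by (intro measure_Un_le) auto
    finally show thesis
      using that[of "-t"] False no_atom by simp
  qed
qed

theorem proposition15:
  fixes M :: "'a measure"
    and X Y :: "'a \<Rightarrow> real"
    and Xs Ys :: "nat \<Rightarrow> 'a \<Rightarrow> real"
    and c :: real
  assumes "prob_space M"
    and "X \<in> borel_measurable M" and "Y \<in> borel_measurable M"
    and "continuous_on UNIV (cdf (distr M borel (\<lambda>\<omega>. X \<omega> - Y \<omega>)))"
    and "prob_space.indep_vars M (\<lambda>_. borel :: (real \<times> real) measure)
           (\<lambda>i \<omega>. (Xs i \<omega>, Ys i \<omega>)) {1..}"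
    and "\<And>i. i \<ge> 1 \<Longrightarrow>
           distr M (borel :: (real \<times> real) measure) (\<lambda>\<omega>. (Xs i \<omega>, Ys i \<omega>)) =
           distr M borel (\<lambda>\<omega>. (X \<omega>, Y \<omega>))"
    and "\<not> st_wj_le M X Y"
  shows "(\<lambda>n. measure M {\<omega> \<in> space M. S_st_wj n (\<lambda>i. Xs i \<omega>) (\<lambda>i. Ys i \<omega>) > c}) \<longlonglongrightarrow> 1"
proof -
  interpret prob_space M by fact
  note [measurable] = assms(2,3)
  obtain s where s: "s \<ge> 0"
    "prob {\<omega> \<in> space M. Y \<omega> - X \<omega> > s} < prob {\<omega> \<in> space M. X \<omega> - Y \<omega> > s}"
    using not_st_wj_le_nonneg_level[OF assms(2-4,7)] by blast
  \<comment> \<open>The average of \<open>h\<close> over the sample is the empirical difference at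
    \<open>s\<close>, and its expectation \<open>\<delta>\<close> is the gap between the two
    probabilities there.\<close>
  define h :: "real \<times> real \<Rightarrow> real"
    where "h = (\<lambda>p. indicator {s<..} (fst p - snd p) - indicator {s<..} (snd p - fst p))"
  have h[measurable]: "h \<in> borel_measurable borel"
    unfolding h_def borel_prod[symmetric] by measurable
  have h_bounds: "h p \<in> {-1..1}" for p
    by (auto simp: h_def indicator_def)
  have pair[measurable]: "(\<lambda>\<omega>. (X \<omega>, Y \<omega>)) \<in> borel_measurable M"
    unfolding borel_prod[symmetric] by measurable
  have pairs: "(\<lambda>\<omega>. (Xs i \<omega>, Ys i \<omega>)) \<in> borel_measurable M" if "i \<ge> 1" for i
    using assms(5) that by (auto simp: indep_vars_def)
  \<comment> \<open>Independence supplies measurability of the pairs only; the coordinates follow by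
    composing with the continuous projections.\<close>
  have Xs: "Xs i \<in> borel_measurable M" and Ys: "Ys i \<in> borel_measurable M" if "i \<ge> 1" for i
    using measurable_compose[OF pairs[OF that] borel_measurable_continuous_onI[of fst]]
      measurable_compose[OF pairs[OF that] borel_measurable_continuous_onI[of snd]]
    by (simp_all add: continuous_on_fst continuous_on_snd)
  define \<delta> where "\<delta> = expectation (\<lambda>\<omega>. h (X \<omega>, Y \<omega>))"
  have "\<delta> = expectation (\<lambda>\<omega>. indicator {\<omega> \<in> space M. X \<omega> - Y \<omega> > s} \<omega>
      - indicator {\<omega> \<in> space M. Y \<omega> - X \<omega> > s} \<omega>)"
    unfolding \<delta>_def h_def by (intro Bochner_Integration.integral_cong) (auto simp: indicator_def)
  also have "\<dots> = prob {\<omega> \<in> space M. X \<omega> - Y \<omega> > s} - prob {\<omega> \<in> space M. Y \<omega> - X \<omega> > s}"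
    by (subst Bochner_Integration.integral_diff) (auto simp: less_top[symmetric])
  finally have "\<delta> > 0"
    using s by simp

  let ?S = "\<lambda>n \<omega>. S_st_wj n (\<lambda>i. Xs i \<omega>) (\<lambda>i. Ys i \<omega>)"
  \<comment> \<open>The exponent is Hoeffding's
    \<open>2 * \<epsilon>\<^sup>2 / (n * (b - a)\<^sup>2)\<close> with deviation
    \<open>\<epsilon> = n * \<delta> / 2\<close> and range \<open>b - a = 2\<close>.\<close>
  have lower: "1 - exp (- real n * (\<delta>\<^sup>2 / 8)) \<le> prob {\<omega> \<in> space M. c < ?S n \<omega>}"
    if n: "n > 0" and large: "c \<le> sqrt n * (\<delta> / 2)" for n
  proof -
    let ?Z = "\<lambda>i \<omega>. h (Xs i \<omega>, Ys i \<omega>)"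
    interpret Z: Hoeffding_ineq_iid M "{1..n}" ?Z "\<lambda>\<omega>. h (X \<omega>, Y \<omega>)" "-1" 1 \<delta>
    proof unfold_locales
      show "indep_vars (\<lambda>_. borel) ?Z {1..n}"
        by (rule indep_vars_compose2[OF indep_vars_subset[OF assms(5)]]) auto
      show "distr M borel (?Z i) = distr M borel (\<lambda>\<omega>. h (X \<omega>, Y \<omega>))" if "i \<in> {1..n}" for i
      proof -
        \<comment> \<open>The law of \<open>?Z i\<close> is the image under \<open>h\<close> of the
          law of the pair, which is the same for all \<open>i\<close>.\<close>
        have "distr M borel (?Z i) = distr (distr M borel (\<lambda>\<omega>. (Xs i \<omega>, Ys i \<omega>))) borel h"
          using that pairs by (subst distr_distr) (auto simp: o_def)
        also have "\<dots> = distr M borel (\<lambda>\<omega>. h (X \<omega>, Y \<omega>))"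
          using that assms(6) by (simp add: distr_distr o_def)
        finally show ?thesis .
      qed
      show "AE \<omega> in M. h (X \<omega>, Y \<omega>) \<in> {-1..1}"
        using h_bounds by simp
    qed (simp_all add: \<delta>_def)
    have Zm[measurable]: "(\<lambda>\<omega>. \<Sum>i=1..n. ?Z i \<omega>) \<in> borel_measurable M"
      by (intro borel_measurable_sum Z.random_variable)
    have "1 - exp (- real n * (\<delta>\<^sup>2 / 8))
        \<le> 1 - prob {\<omega> \<in> space M. (\<Sum>i=1..n. ?Z i \<omega>) \<le> real n * \<delta> - real n * (\<delta> / 2)}"
      using Z.Hoeffding_ineq_le[of "real n * (\<delta> / 2)"] n \<open>\<delta> > 0\<close>
      by (simp add: power2_eq_square field_simps)
    also have "\<dots> = prob {\<omega> \<in> space M. \<not> (\<Sum>i=1..n. ?Z i \<omega>) \<le> real n * \<delta> - real n * (\<delta> / 2)}"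
      by (rule prob_neg[symmetric]) simp
    also have "\<dots> \<le> prob {\<omega> \<in> space M. c < ?S n \<omega>}"
    \<comment> \<open>Monotonicity of the measure needs the larger event to be measurable, which is
      where the reduction to rational levels enters.\<close>
    proof (intro finite_measure_mono sets_less_S_st_wj[OF n])
      show "{\<omega> \<in> space M. \<not> (\<Sum>i=1..n. ?Z i \<omega>) \<le> real n * \<delta> - real n * (\<delta> / 2)}
          \<subseteq> {\<omega> \<in> space M. c < ?S n \<omega>}"
      proof safe
        fix \<omega> assume "\<not> (\<Sum>i=1..n. ?Z i \<omega>) \<le> real n * \<delta> - real n * (\<delta> / 2)"
        then have "\<delta> / 2 < (1 / real n) * (\<Sum>i=1..n. ?Z i \<omega>)"
          using n by (simp add: field_simps)
        moreover have "c / sqrt n \<le> \<delta> / 2"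
          using large n by (simp add: pos_divide_le_eq mult.commute)
        moreover have "(1 / real n) * (\<Sum>i=1..n. ?Z i \<omega>) = emp_surv n (\<lambda>i. Xs i \<omega> - Ys i \<omega>) s
            - emp_surv n (\<lambda>i. Ys i \<omega> - Xs i \<omega>) s"
          by (simp add: emp_surv_def h_def sum_subtractf diff_divide_distrib)
        ultimately have "c / sqrt n < emp_surv n (\<lambda>i. Xs i \<omega> - Ys i \<omega>) s
            - emp_surv n (\<lambda>i. Ys i \<omega> - Xs i \<omega>) s"
          by linarith
        \<comment> \<open>As \<open>s \<ge> 0\<close>, the level \<open>s\<close> is among those
          over which the supremum is taken.\<close>
        then show "c < ?S n \<omega>"
          using s(1) n by (auto simp: less_S_st_wj_iff)
      qed
    qed (use Xs Ys in auto)
    finally show ?thesis .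
  qed

  have "filterlim (\<lambda>n. sqrt (real n) * (\<delta> / 2)) at_top sequentially"
    using \<open>\<delta> > 0\<close> by real_asymp
  then have "eventually (\<lambda>n. c \<le> sqrt (real n) * (\<delta> / 2)) sequentially"
    by (simp add: filterlim_at_top)
  then have ev: "eventually (\<lambda>n. 1 - exp (- real n * (\<delta>\<^sup>2 / 8)) \<le> prob {\<omega> \<in> space M. c < ?S n \<omega>})
      sequentially"
    using eventually_gt_at_top[of 0] by eventually_elim (rule lower)
  have "(\<lambda>n. 1 - exp (- real n * (\<delta>\<^sup>2 / 8))) \<longlonglongrightarrow> 1"
    using \<open>\<delta> > 0\<close> by real_asymp
  \<comment> \<open>The probabilities are squeezed between the Hoeffding lower bound, valid for
    large \<open>n\<close>, and the constant 1.\<close>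
  then show ?thesis
    by (intro tendsto_sandwich[OF ev _ _ tendsto_const]) simp_all
qed

end
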